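(* Let $G$ be a connected graph of order $n$ with distance Seidel eigenvalues $\partial_1^S,\dots,\partial_n^S$. Then the distance Seidel eigenvalues of the lexicographic product $G[K_2]$ are $2\partial_r^S-1$ for $r=1,\dots,n$ (each once), together with $1$ with multiplicity $n$.
   Context: For a connected graph $G$ with distance matrix $\mathcal{D}(G)$, the distance Seidel matrix is $\mathcal{D}^S(G)=J-I-2\mathcal{D}(G)$ ($J$ all-ones); its eigenvalues are the distance Seidel eigenvalues. The lexicographic product $G_1[G_2]$ has vertex set $V(G_1)\times V(G_2)$, with $(v_1,u_1)\sim(v_2,u_2)$ iff $v_1v_2\in E(G_1)$, or $v_1=v_2$ and $u_1u_2\in E(G_2)$. *)

theory Defs
  imports
    "Graph_Theory.Graph_Theory"
    "Graph_Theory.Kuratowski"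
    "Jordan_Normal_Form.Char_Poly"
begin

text \<open>
  A finite simple graph is a \<^locale>\<open>pair_graph\<close>: each edge is represented by its two
  opposite arcs, and there are no loops.
\<close>

text \<open>
  The distance is the unit-cost case of the shortest-path value from the library. That value is an
  infimum in \<^typ>\<open>ereal\<close>, finite whenever the two vertices are connected by a walk.
\<close>
definition graph_dist :: "'a pair_pre_digraph \<Rightarrow> 'a \<Rightarrow> 'a \<Rightarrow> real" where
  "graph_dist G u v = real_of_ereal (wf_digraph.\<mu> (with_proj G) (\<lambda>_. 1) u v)"

text \<open>
  Matrices are indexed by \<^typ>\<open>nat\<close>, so the vertices are listed in some order \<open>vs\<close>; this is
  meant for \<^prop>\<open>distinct vs\<close> and \<^prop>\<open>set vs = pverts G\<close>. Another order conjugates the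
  matrices by a permutation matrix.
\<close>
definition distance_matrix :: "'a pair_pre_digraph \<Rightarrow> 'a list \<Rightarrow> real mat" where
  "distance_matrix G vs =
     mat (length vs) (length vs) (\<lambda>(i, j). graph_dist G (vs ! i) (vs ! j))"

definition all_ones_mat :: "nat \<Rightarrow> real mat" where
  "all_ones_mat n = mat n n (\<lambda>_. 1)"

definition distance_seidel_matrix :: "'a pair_pre_digraph \<Rightarrow> 'a list \<Rightarrow> real mat" where
  "distance_seidel_matrix G vs =
     all_ones_mat (length vs) - 1\<^sub>m (length vs) - 2 \<cdot>\<^sub>m distance_matrix G vs"

text \<open>
  The eigenvalues with multiplicity. The matrix is real symmetric, so all of its eigenvalues are
  real and no root of the characteristic polynomial is lost by working over \<^typ>\<open>real\<close>.
\<close>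
definition distance_seidel_eigenvalues :: "'a pair_pre_digraph \<Rightarrow> 'a list \<Rightarrow> real multiset" where
  "distance_seidel_eigenvalues G vs = proots (char_poly (distance_seidel_matrix G vs))"

definition lex_product ::
  "'a pair_pre_digraph \<Rightarrow> 'b pair_pre_digraph \<Rightarrow> ('a \<times> 'b) pair_pre_digraph" where
  "lex_product G H =
     \<lparr> pverts = pverts G \<times> pverts H,
       parcs = {((v1, u1), (v2, u2)).
         v1 \<in> pverts G \<and> v2 \<in> pverts G \<and> u1 \<in> pverts H \<and> u2 \<in> pverts H \<and>
         ((v1, v2) \<in> parcs G \<or> v1 = v2 \<and> (u1, u2) \<in> parcs H)} \<rparr>"

end

theory Submission
  imports Defs
begin

text \<open>
  Listing the vertices of \<open>G[K\<^sub>2]\<close> one copy of \<open>G\<close> after the other, the distance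
  Seidel matrix is the block matrix with diagonal blocks \<open>S\<close> and off-diagonal blocks \<open>S - I\<close>,
  where \<open>S\<close> is the distance Seidel matrix of \<open>G\<close>: two vertices over different vertices of \<open>G\<close>
  keep their distance, and the two vertices over the same vertex are adjacent. Since the blocks
  commute, the characteristic polynomial factors into those of \<open>S - (S - I) = I\<close> and
  \<open>S + (S - I) = 2 S - I\<close>.
\<close>

section \<open>Roots and characteristic polynomials\<close>

text \<open>An affine substitution with \<open>d \<noteq> 0\<close> turns the linear factor at
  \<open>c + d * x\<close> into \<open>d\<close> times the linear factor at \<open>x\<close>. The
  exact power of the factor therefore survives, and the cofactor still does not vanish at
  \<open>x\<close>.\<close>

lemma order_pcompose_linear:
  fixes p :: "'a :: field poly"
  assumes "p \<noteq> 0" "d \<noteq> 0"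
  shows "order x (p \<circ>\<^sub>p [:c, d:]) = order (c + d * x) p"
proof -
  define k where "k = order (c + d * x) p"
  obtain q where q: "p = [:- (c + d * x), 1:] ^ k * q" "\<not> [:- (c + d * x), 1:] dvd q"
    using order_decomp[OF assms(1)] unfolding k_def by blast
  have lin: "[:- (c + d * x), 1:] \<circ>\<^sub>p [:c, d:] = Polynomial.smult d [:- x, 1:]"
    by (simp add: pcompose_pCons algebra_simps)
  have eq: "p \<circ>\<^sub>p [:c, d:] = [:- x, 1:] ^ k * Polynomial.smult (d ^ k) (q \<circ>\<^sub>p [:c, d:])"
    by (subst q(1)) (simp only: pcompose_mult pcompose_hom.hom_power lin smult_power
        mult_smult_left mult_smult_right)
  have root: "poly (q \<circ>\<^sub>p [:c, d:]) x \<noteq> 0"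
    using q(2) by (simp add: poly_pcompose poly_eq_0_iff_dvd mult.commute)
  show ?thesis
    unfolding k_def[symmetric]
  proof (rule Polynomial.order_unique_lemma)
    show "[:- x, 1:] ^ k dvd p \<circ>\<^sub>p [:c, d:]"
      unfolding eq by (rule dvd_triv_left)
    have "\<not> [:- x, 1:] dvd Polynomial.smult (d ^ k) (q \<circ>\<^sub>p [:c, d:])"
      using root assms(2) by (simp add: poly_eq_0_iff_dvd[symmetric])
    then show "\<not> [:- x, 1:] ^ Suc k dvd p \<circ>\<^sub>p [:c, d:]"
      unfolding eq power_Suc2 dvd_mult_cancel_left by simp
  qed
qed

lemma proots_pcompose_linear:
  fixes p :: "'a :: field poly"
  assumes "d \<noteq> 0"
  shows "proots (p \<circ>\<^sub>p [:c, d:]) = image_mset (\<lambda>x. (x - c) / d) (proots p)"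
proof (cases "p = 0")
  case False
  have nz: "p \<circ>\<^sub>p [:c, d:] \<noteq> 0"
    using False assms by (simp add: pcompose_eq_0_iff)
  show ?thesis
  proof (rule multiset_eqI)
    fix x
    \<comment> \<open>The affine map is injective, so the count of an image is the count at a single
      preimage rather than a sum over a fibre.\<close>
    have "(\<lambda>x. (x - c) / d) -` {x} = {c + d * x}"
      using assms by (auto simp: field_simps)
    then have "count (image_mset (\<lambda>x. (x - c) / d) (proots p)) x = count (proots p) (c + d * x)"
      by (cases "c + d * x \<in># proots p") (simp_all add: count_image_mset not_in_iff)
    then show "count (proots (p \<circ>\<^sub>p [:c, d:])) x = count (image_mset (\<lambda>x. (x - c) / d) (proots p)) x"
      using nz False order_pcompose_linear[OF False assms] by simp
  qed
qed simp

section \<open>Characteristic polynomials of reindexed and of block matrices\<close>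

lemma poly_char_poly:
  fixes A :: "'a :: comm_ring_1 mat"
  assumes "A \<in> carrier_mat n n"
  shows "poly (char_poly A) x = det (x \<cdot>\<^sub>m 1\<^sub>m n - A)"
  unfolding char_poly_def
  by (rule poly_det_cong[of _ n]) (use assms in \<open>auto simp: char_poly_matrix_def\<close>)

text \<open>Permuting rows and columns simultaneously amounts to permuting rows twice with a
  transposition in between. Each row permutation contributes the sign of \<open>p\<close>, and the
  two signs cancel.\<close>

lemma det_reindex:
  assumes A: "A \<in> carrier_mat n n" and p: "p permutes {0..<n}"
  shows "det (mat n n (\<lambda>(i, j). A $$ (p i, p j))) = det A"
proof -
  have lt: "p i < n" if "i < n" for i
    using permutes_in_image[OF p, of i] that by simp
  define B where "B = transpose_mat (mat n n (\<lambda>(i, j). A $$ (p i, j)))"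
  have B: "B \<in> carrier_mat n n"
    by (simp add: B_def)
  have "mat n n (\<lambda>(i, j). A $$ (p i, p j)) = transpose_mat (mat n n (\<lambda>(i, j). B $$ (p i, j)))"
    by (rule eq_matI) (auto simp: B_def lt)
  then have "det (mat n n (\<lambda>(i, j). A $$ (p i, p j))) = signof p * det B"
    by (simp add: det_transpose[of _ n] det_permute_rows[OF B p])
  also have "det B = signof p * det A"
    by (simp add: B_def det_transpose[of _ n] det_permute_rows[OF A p])
  also have "signof p * (signof p * det A) = det A"
    by (simp add: sign_def)
  finally show ?thesis .
qed

text \<open>Since \<open>p\<close> is injective, diagonal positions stay diagonal, so reindexing
  commutes with forming the characteristic matrix and \<open>det_reindex\<close> applies to the
  latter.\<close>

lemma char_poly_reindex:
  assumes A: "A \<in> carrier_mat n n" and p: "p permutes {0..<n}"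
  shows "char_poly (mat n n (\<lambda>(i, j). A $$ (p i, p j))) = char_poly A"
proof -
  have lt: "p i < n" if "i < n" for i
    using permutes_in_image[OF p, of i] that by simp
  have "char_poly_matrix (mat n n (\<lambda>(i, j). A $$ (p i, p j))) =
      mat n n (\<lambda>(i, j). char_poly_matrix A $$ (p i, p j))"
    using A by (intro eq_matI) (auto simp: char_poly_matrix_def lt inj_eq[OF permutes_inj[OF p]])
  then show ?thesis
    unfolding char_poly_def using det_reindex[OF char_poly_matrix_closed[OF A] p] by simp
qed

text \<open>For commuting lower blocks the block determinant is \<open>det (A * A - B * B)\<close>.
  Commutation is used a second time to factor this difference of squares.\<close>

lemma det_symmetric_block_mat:
  fixes A B :: "'a :: idom mat"
  assumes A: "A \<in> carrier_mat n n" and B: "B \<in> carrier_mat n n" and comm: "A * B = B * A"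
  shows "det (four_block_mat A B B A) = det (A - B) * det (A + B)"
proof -
  have "A * A - B * B = (A - B) * (A + B)"
  proof -
    have "(A - B) * (A + B) = A * A + A * B - (B * A + B * B)"
      using A B
      by (subst minus_mult_distrib_mat[of A n n]) (auto simp: mult_add_distrib_mat[of _ n n _ n])
    also have "\<dots> = A * A - B * B"
      unfolding comm by (rule eq_matI) (use A B in auto)
    finally show ?thesis by simp
  qed
  moreover have "det ((A - B) * (A + B)) = det (A - B) * det (A + B)"
    by (rule det_mult[of _ n]) (use A B in auto)
  ultimately show ?thesis
    using det_four_block_mat[OF A B B A comm[symmetric]] by simp
qed

text \<open>Real polynomials are equal once they agree at every point, so the claim becomes an
  identity of determinants of real matrices.\<close>

lemma char_poly_doubled:
  fixes S :: "real mat"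
  assumes S: "S \<in> carrier_mat n n"
  shows "char_poly (four_block_mat S (S - 1\<^sub>m n) (S - 1\<^sub>m n) S) =
    [:- 1, 1:] ^ n * Polynomial.smult (2 ^ n) (char_poly S \<circ>\<^sub>p [:1 / 2, 1 / 2:])"
proof (rule poly_eq_poly_eq_iff[THEN iffD1], rule ext)
  fix x :: real
  define A where "A = x \<cdot>\<^sub>m 1\<^sub>m n - S"
  define B where "B = 1\<^sub>m n - S"
  have AB: "A \<in> carrier_mat n n" "B \<in> carrier_mat n n"
    using S by (auto simp: A_def B_def)
  \<comment> \<open>\<open>A\<close> differs from \<open>B\<close> by a scalar matrix, which is why
    the two commute.\<close>
  have AB_sum: "A = (x - 1) \<cdot>\<^sub>m 1\<^sub>m n + B"
    by (rule eq_matI) (use S in \<open>auto simp: A_def B_def\<close>)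
  have comm: "A * B = B * A"
    unfolding AB_sum using AB(2)
    by (simp add: add_mult_distrib_mat[of _ n n] mult_add_distrib_mat[of _ n n _ n]
        mult_smult_distrib[of _ n n _ n] mult_smult_assoc_mat[of _ n n _ n])
  have "poly (char_poly (four_block_mat S (S - 1\<^sub>m n) (S - 1\<^sub>m n) S)) x =
      det (x \<cdot>\<^sub>m 1\<^sub>m (n + n) - four_block_mat S (S - 1\<^sub>m n) (S - 1\<^sub>m n) S)"
    by (rule poly_char_poly) (use S in auto)
  also have "x \<cdot>\<^sub>m 1\<^sub>m (n + n) - four_block_mat S (S - 1\<^sub>m n) (S - 1\<^sub>m n) S = four_block_mat A B B A"
    by (rule eq_matI) (use S in \<open>auto simp: A_def B_def\<close>)
  also have "det (four_block_mat A B B A) = det (A - B) * det (A + B)"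
    by (rule det_symmetric_block_mat[OF AB comm])
  also have "A - B = (x - 1) \<cdot>\<^sub>m 1\<^sub>m n"
    by (rule eq_matI) (use S in \<open>auto simp: A_def B_def\<close>)
  \<comment> \<open>Pulling out 2 leaves the matrix whose determinant is the characteristic
    polynomial of \<open>S\<close> at \<open>(x + 1) / 2\<close>; this is the origin of both the
    factor \<open>2 ^ n\<close> and the substitution.\<close>
  also have "A + B = 2 \<cdot>\<^sub>m ((x + 1) / 2 \<cdot>\<^sub>m 1\<^sub>m n - S)"
    by (rule eq_matI) (use S in \<open>auto simp: A_def B_def field_simps\<close>)
  also have "det ((x - 1) \<cdot>\<^sub>m 1\<^sub>m n) * det (2 \<cdot>\<^sub>m ((x + 1) / 2 \<cdot>\<^sub>m 1\<^sub>m n - S)) =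
      (x - 1) ^ n * (2 ^ n * poly (char_poly S) ((x + 1) / 2))"
    using S by (simp add: poly_char_poly[OF S] det_smult)
  finally show "poly (char_poly (four_block_mat S (S - 1\<^sub>m n) (S - 1\<^sub>m n) S)) x =
      poly ([:- 1, 1:] ^ n * Polynomial.smult (2 ^ n) (char_poly S \<circ>\<^sub>p [:1 / 2, 1 / 2:])) x"
    by (simp add: poly_pcompose poly_power add_divide_distrib algebra_simps)
qed

text \<open>The constant \<open>2 ^ n\<close> does not affect roots, the power of the linear factor
  gives \<open>n\<close> copies of 1, and inverting the substitution sends a root \<open>x\<close>
  to \<open>(x - 1 / 2) / (1 / 2) = 2 * x - 1\<close>.\<close>

lemma proots_char_poly_doubled:
  fixes S :: "real mat"
  assumes S: "S \<in> carrier_mat n n"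
  shows "proots (char_poly (four_block_mat S (S - 1\<^sub>m n) (S - 1\<^sub>m n) S)) =
    image_mset (\<lambda>x. 2 * x - 1) (proots (char_poly S)) + replicate_mset n 1"
proof -
  have "char_poly S \<noteq> 0"
    using degree_monic_char_poly[OF S] by auto
  then have "char_poly S \<circ>\<^sub>p [:1 / 2, 1 / 2:] \<noteq> 0"
    by (simp add: pcompose_eq_0_iff)
  moreover have "repeat_mset n {#1 :: real#} = replicate_mset n 1"
    by (rule multiset_eqI) simp
  moreover have "(\<lambda>x :: real. (x - 1 / 2) / (1 / 2)) = (\<lambda>x. 2 * x - 1)"
    by (simp add: fun_eq_iff)
  ultimately show ?thesis
    unfolding char_poly_doubled[OF S]
    using proots_pcompose_linear[of "1 / 2" "char_poly S" "1 / 2"]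
    by (simp add: proots_mult proots_power)
qed

section \<open>Distances in the lexicographic product\<close>

lemma (in wf_digraph) awalk_cost_one: "awalk_cost (\<lambda>_. 1) p = real (length p)"
  by (induction p) simp_all

text \<open>With unit costs the infimum runs over walk lengths, so distances can be compared by
  transforming walks.\<close>

lemma graph_dist_altdef:
  assumes "pair_wf_digraph G"
  shows "graph_dist G u v =
    real_of_ereal (INF p\<in>{p. pre_digraph.awalk (with_proj G) u p v}. ereal (real (length p)))"
proof -
  interpret pair_wf_digraph G by fact
  show ?thesis
    unfolding graph_dist_def \<mu>_def awalk_cost_one ..
qed

lemma graph_dist_refl:
  assumes "pair_wf_digraph G" "u \<in> pverts G"
  shows "graph_dist G u u = 0"
proof -
  interpret pair_wf_digraph G by fact
  have "(INF p\<in>{p. awalk u p u}. ereal (real (length p))) = 0"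
  proof (rule antisym)
    show "(INF p\<in>{p. awalk u p u}. ereal (real (length p))) \<le> 0"
      using assms(2) by (intro INF_lower2[of "[]"]) (simp_all add: awalk_Nil_iff)
  qed (rule INF_greatest, simp)
  then show ?thesis
    by (simp add: graph_dist_altdef[OF assms(1)])
qed

lemma graph_dist_adjacent:
  assumes "pair_wf_digraph G" "(u, v) \<in> parcs G" "u \<noteq> v"
  shows "graph_dist G u v = 1"
proof -
  interpret pair_wf_digraph G by fact
  have "(INF p\<in>{p. awalk u p v}. ereal (real (length p))) = 1"
  proof (rule antisym)
    show "(INF p\<in>{p. awalk u p v}. ereal (real (length p))) \<le> 1"
      using assms(2) arc_implies_awalk[of "(u, v)"]
      by (intro INF_lower2[of "[(u, v)]"]) (simp_all add: one_ereal_def)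
    show "1 \<le> (INF p\<in>{p. awalk u p v}. ereal (real (length p)))"
    proof (rule INF_greatest)
      fix p assume "p \<in> {p. awalk u p v}"
      then have "p \<noteq> []"
        using assms(3) by (auto simp: awalk_Nil_iff)
      then show "1 \<le> ereal (real (length p))"
        by (cases p) (simp_all add: one_ereal_def)
    qed
  qed
  then show ?thesis
    by (simp add: graph_dist_altdef[OF assms(1)])
qed

text \<open>The definition of the product restricts the endpoints of its arcs to the vertex set
  explicitly.\<close>

lemma pair_wf_digraph_lex_product: "pair_wf_digraph (lex_product G H)"
  by unfold_locales (auto simp: lex_product_def)

lemma pverts_lex_product: "pverts (lex_product G H) = pverts G \<times> pverts H"
  by (simp add: lex_product_def)

text \<open>The lifted walk keeps the second coordinate \<open>a\<close> until its last arc, which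
  switches to \<open>b\<close>. A nonempty walk is required so that there is an arc on which to
  switch.\<close>

lemma awalk_lex_product_lift:
  assumes G: "pair_wf_digraph G" and "pre_digraph.awalk (with_proj G) u p v" "p \<noteq> []"
    and "a \<in> pverts H" "b \<in> pverts H"
  shows "\<exists>q. pre_digraph.awalk (with_proj (lex_product G H)) (u, a) q (v, b) \<and> length q = length p"
proof -
  interpret G: pair_wf_digraph G by fact
  interpret L: pair_wf_digraph "lex_product G H" by (rule pair_wf_digraph_lex_product)
  show ?thesis
    using assms(2-4)
  proof (induction p arbitrary: u a)
    case (Cons e p)
    then have e: "e \<in> parcs G" "u = fst e" and p: "G.awalk (snd e) p v"
      by (auto simp: G.awalk_Cons_iff)
    have arc: "((u, a), (snd e, c)) \<in> parcs (lex_product G H)" if "c \<in> pverts H" for c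
      using e that Cons.prems G.arc_fst_in_verts[OF e(1)] G.arc_snd_in_verts[OF e(1)]
      by (cases e) (auto simp: lex_product_def)
    show ?case
    proof (cases "p = []")
      case True
      then have "L.awalk (u, a) [((u, a), (v, b))] (v, b)"
        using p arc[OF assms(5)] L.arc_implies_awalk[of "((u, a), (v, b))"]
        by (auto simp: G.awalk_Nil_iff)
      then show ?thesis
        using True by (intro exI[of _ "[((u, a), (v, b))]"]) simp
    next
      case False
      then obtain q where "L.awalk (snd e, a) q (v, b)" "length q = length p"
        using Cons.IH[OF p] Cons.prems by blast
      then show ?thesis
        using arc[OF Cons.prems(3)]
        by (intro exI[of _ "((u, a), (snd e, a)) # q"]) (auto simp: L.awalk_Cons_iff)
    qed
  qed simp
qed

text \<open>Arcs inside a fibre are dropped and all others project to arcs of \<open>G\<close>, so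
  the walk can only become shorter.\<close>

lemma awalk_lex_product_project:
  assumes G: "pair_wf_digraph G" and "pre_digraph.awalk (with_proj (lex_product G H)) x q y"
  shows "\<exists>p. pre_digraph.awalk (with_proj G) (fst x) p (fst y) \<and> length p \<le> length q"
proof -
  interpret G: pair_wf_digraph G by fact
  interpret L: pair_wf_digraph "lex_product G H" by (rule pair_wf_digraph_lex_product)
  show ?thesis
    using assms(2)
  proof (induction q arbitrary: x)
    case Nil
    then show ?case
      by (intro exI[of _ "[]"]) (auto simp: L.awalk_Nil_iff G.awalk_Nil_iff pverts_lex_product)
  next
    case (Cons e q)
    then have e: "e \<in> parcs (lex_product G H)" "x = fst e" and q: "L.awalk (snd e) q y"
      by (auto simp: L.awalk_Cons_iff)
    obtain p where p: "G.awalk (fst (snd e)) p (fst y)" "length p \<le> length q"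
      using Cons.IH[OF q] by blast
    from e consider "(fst x, fst (snd e)) \<in> parcs G" | "fst x = fst (snd e)"
      by (auto simp: lex_product_def)
    then show ?case
    proof cases
      case 1
      then show ?thesis
        using p by (intro exI[of _ "(fst x, fst (snd e)) # p"]) (auto simp: G.awalk_Cons_iff)
    next
      case 2
      then show ?thesis
        using p by (intro exI[of _ p]) auto
    qed
  qed
qed

text \<open>Lifting and projecting walks bound each infimum by the other. As
  \<open>u \<noteq> v\<close>, every walk from \<open>u\<close> to \<open>v\<close> is nonempty and
  can be lifted.\<close>

lemma graph_dist_lex_product:
  assumes G: "pair_wf_digraph G" and "u \<noteq> v" "a \<in> pverts H" "b \<in> pverts H"
  shows "graph_dist (lex_product G H) (u, a) (v, b) = graph_dist G u v"
proof -
  interpret G: pair_wf_digraph G by fact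
  interpret L: pair_wf_digraph "lex_product G H" by (rule pair_wf_digraph_lex_product)
  have "(INF q\<in>{q. L.awalk (u, a) q (v, b)}. ereal (real (length q))) =
      (INF p\<in>{p. G.awalk u p v}. ereal (real (length p)))"
  proof (rule antisym; rule INF_mono)
    fix p assume "p \<in> {p. G.awalk u p v}"
    moreover from this have "p \<noteq> []"
      using assms(2) by (auto simp: G.awalk_Nil_iff)
    ultimately obtain q where "L.awalk (u, a) q (v, b)" "length q = length p"
      using awalk_lex_product_lift[OF G _ _ assms(3,4), of u p v] by auto
    then show "\<exists>q\<in>{q. L.awalk (u, a) q (v, b)}. ereal (real (length q)) \<le> ereal (real (length p))"
      by auto
  next
    fix q assume "q \<in> {q. L.awalk (u, a) q (v, b)}"
    then obtain p where "G.awalk u p v" "length p \<le> length q"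
      using awalk_lex_product_project[OF G, of H "(u, a)" q "(v, b)"] by auto
    then show "\<exists>p\<in>{p. G.awalk u p v}. ereal (real (length p)) \<le> ereal (real (length q))"
      by auto
  qed
  then show ?thesis
    by (simp only: graph_dist_altdef[OF G] graph_dist_altdef[OF L.pair_wf_digraph_axioms])
qed

section \<open>Distance Seidel matrices\<close>

lemma distance_seidel_matrix_carrier:
  "distance_seidel_matrix G vs \<in> carrier_mat (length vs) (length vs)"
  unfolding distance_seidel_matrix_def distance_matrix_def
  by (intro minus_carrier_mat smult_carrier_mat mat_carrier)

lemma distance_seidel_matrix_index:
  assumes "i < length vs" "j < length vs"
  shows "distance_seidel_matrix G vs $$ (i, j) =
    1 - (if i = j then 1 else 0) - 2 * graph_dist G (vs ! i) (vs ! j)"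
  using assms by (simp add: distance_seidel_matrix_def distance_matrix_def all_ones_mat_def)

text \<open>Two duplicate-free listings of one set differ by a permutation, which reindexes the
  matrix. This allows the vertices of the product to be listed in the order that produces
  blocks.\<close>

lemma distance_seidel_eigenvalues_cong:
  assumes "distinct vs" "distinct ws" "set vs = set ws"
  shows "distance_seidel_eigenvalues G vs = distance_seidel_eigenvalues G ws"
proof -
  have "mset vs = mset ws"
    using assms by (simp add: set_eq_iff_mset_eq_distinct)
  then obtain p where p: "p permutes {..<length ws}" "permute_list p ws = vs"
    by (rule mset_eq_permutation)
  have len: "length vs = length ws"
    using \<open>mset vs = mset ws\<close> by (rule mset_eq_length)
  have p': "p permutes {0..<length ws}"
    using p(1) by (simp add: atLeast0LessThan)
  have lt: "p i < length ws" if "i < length ws" for i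
    using permutes_in_image[OF p(1), of i] that by simp
  have nth: "vs ! i = ws ! p i" if "i < length ws" for i
    using p that by (metis permute_list_nth)
  have "distance_seidel_matrix G vs =
      mat (length ws) (length ws) (\<lambda>(i, j). distance_seidel_matrix G ws $$ (p i, p j))"
    using distance_seidel_matrix_carrier[of G vs] len
    by (intro eq_matI)
      (auto simp: distance_seidel_matrix_index lt nth inj_eq[OF permutes_inj[OF p(1)]])
  then show ?thesis
    by (simp add: distance_seidel_eigenvalues_def
        char_poly_reindex[OF distance_seidel_matrix_carrier p'])
qed

text \<open>Only the diagonals of the off-diagonal blocks need care: there two adjacent vertices of
  one fibre give the entry \<open>1 - 2 * 1 = -1\<close>, while the diagonal of \<open>S\<close> is
  0, hence the block \<open>S - 1\<^sub>m n\<close>.\<close>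

lemma distance_seidel_matrix_lex_product_K2:
  assumes G: "pair_wf_digraph G" and vs: "distinct vs" "set vs = pverts G"
    and H: "pverts H = {a, b}" "a \<noteq> b" "(a, b) \<in> parcs H" "(b, a) \<in> parcs H"
  defines "S \<equiv> distance_seidel_matrix G vs"
  defines "n \<equiv> length vs"
  shows "distance_seidel_matrix (lex_product G H) (map (\<lambda>v. (v, a)) vs @ map (\<lambda>v. (v, b)) vs) =
    four_block_mat S (S - 1\<^sub>m n) (S - 1\<^sub>m n) S"
proof -
  let ?L = "lex_product G H"
  have L: "pair_wf_digraph ?L"
    by (rule pair_wf_digraph_lex_product)
  have S: "S \<in> carrier_mat n n"
    unfolding S_def n_def by (rule distance_seidel_matrix_carrier)
  \<comment> \<open>Both sides are 0; in this form the case combines with \<open>other\<close> into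
    \<open>dist_same\<close>.\<close>
  have same: "graph_dist ?L (v, c) (v, c) = graph_dist G v v" if "v \<in> pverts G" "c \<in> {a, b}" for v c
    using that graph_dist_refl[OF G] graph_dist_refl[OF L, of "(v, c)"] H(1)
    by (simp add: lex_product_def)
  have flip: "graph_dist ?L (v, c) (v, d) = 1"
    if "v \<in> pverts G" "c \<in> {a, b}" "d \<in> {a, b}" "c \<noteq> d" for v c d
    by (rule graph_dist_adjacent[OF L]) (use that H in \<open>auto simp: lex_product_def\<close>)
  have other: "graph_dist ?L (u, c) (v, d) = graph_dist G u v"
    if "u \<noteq> v" "c \<in> {a, b}" "d \<in> {a, b}" for u v c d
    by (rule graph_dist_lex_product[OF G]) (use that H(1) in auto)
  have nth_in: "vs ! i \<in> pverts G" if "i < n" for i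
    using that vs(2) nth_mem unfolding n_def by blast
  have dist_same: "graph_dist ?L (vs ! i, c) (vs ! j, c) = graph_dist G (vs ! i) (vs ! j)"
    if "i < n" "j < n" "c \<in> {a, b}" for i j c
    using that same other nth_in by (cases "vs ! i = vs ! j") auto
  have dist_diff: "graph_dist ?L (vs ! i, c) (vs ! j, d) =
      (if i = j then 1 else graph_dist G (vs ! i) (vs ! j))"
    if "i < n" "j < n" "c \<in> {a, b}" "d \<in> {a, b}" "c \<noteq> d" for i j c d
    using that flip other nth_in vs(1) by (auto simp: nth_eq_iff_index_eq n_def)
  have dist_refl: "graph_dist G (vs ! i) (vs ! i) = 0" if "i < n" for i
    using graph_dist_refl[OF G nth_in[OF that]] .
  have S_index: "S $$ (i, j) = 1 - (if i = j then 1 else 0) - 2 * graph_dist G (vs ! i) (vs ! j)"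
    if "i < n" "j < n" for i j
    using that unfolding S_def n_def by (rule distance_seidel_matrix_index)
  let ?ws = "map (\<lambda>v. (v, a)) vs @ map (\<lambda>v. (v, b)) vs"
  show ?thesis
  proof (rule eq_matI)
    fix i j
    assume "i < dim_row (four_block_mat S (S - 1\<^sub>m n) (S - 1\<^sub>m n) S)"
      "j < dim_col (four_block_mat S (S - 1\<^sub>m n) (S - 1\<^sub>m n) S)"
    then have ij: "i < n + n" "j < n + n"
      using S by auto
    \<comment> \<open>A position in the concatenated list lies in the first copy, or becomes a valid
      index of \<open>vs\<close> after subtracting \<open>n\<close>.\<close>
    then have ij': "i < n \<or> i - n < n" "j < n \<or> j - n < n"
      by auto
    have "distance_seidel_matrix ?L ?ws $$ (i, j) =
        1 - (if i = j then 1 else 0) - 2 * graph_dist ?L (?ws ! i) (?ws ! j)"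
      by (rule distance_seidel_matrix_index) (use ij in \<open>auto simp: n_def\<close>)
    then show "distance_seidel_matrix ?L ?ws $$ (i, j) =
        four_block_mat S (S - 1\<^sub>m n) (S - 1\<^sub>m n) S $$ (i, j)"
      using S ij ij' H(2)
      by (auto simp: nth_append S_index dist_same dist_diff dist_refl n_def[symmetric])
  qed (use S distance_seidel_matrix_carrier[of ?L ?ws] in \<open>auto simp: n_def\<close>)
qed

theorem theorem6p5:
  fixes G :: "'a pair_pre_digraph" and K2 :: "'b pair_pre_digraph"
    and n :: nat and ev :: "nat \<Rightarrow> real"
    and vs :: "'a list" and ws :: "('a \<times> 'b) list"
  assumes "pair_graph G" and "connected (with_proj G)" and "card (pverts G) = n"
    and "complete_digraph 2 (with_proj K2)"
    and "distinct vs" and "set vs = pverts G"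
    and "distinct ws" and "set ws = pverts (lex_product G K2)"
    and "distance_seidel_eigenvalues G vs = image_mset ev (mset_set {1..n})"
  shows "distance_seidel_eigenvalues (lex_product G K2) ws =
           image_mset (\<lambda>r. 2 * ev r - 1) (mset_set {1..n}) + replicate_mset n 1"
proof -
  interpret G: pair_graph G by fact
  have len: "length vs = n"
    using assms(3,5,6) distinct_card by fastforce
  \<comment> \<open>Completeness on two vertices supplies the arcs in both directions.\<close>
  obtain a b where K2: "pverts K2 = {a, b}" "a \<noteq> b" "(a, b) \<in> parcs K2" "(b, a) \<in> parcs K2"
    using assms(4) unfolding complete_digraph_pair_def by (auto simp: card_2_iff)
  define S where "S = distance_seidel_matrix G vs"
  have S: "S \<in> carrier_mat n n"
    unfolding S_def len[symmetric] by (rule distance_seidel_matrix_carrier)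
  let ?ws = "map (\<lambda>v. (v, a)) vs @ map (\<lambda>v. (v, b)) vs"
  \<comment> \<open>The arbitrary listing \<open>ws\<close> is replaced by the copy of
    \<open>vs\<close> at \<open>a\<close> followed by the copy at \<open>b\<close>.\<close>
  have "distance_seidel_eigenvalues (lex_product G K2) ws =
      distance_seidel_eigenvalues (lex_product G K2) ?ws"
    using assms(5-8) K2(1,2)
    by (intro distance_seidel_eigenvalues_cong)
      (auto simp: distinct_map inj_on_def lex_product_def)
  also have "\<dots> = proots (char_poly (four_block_mat S (S - 1\<^sub>m n) (S - 1\<^sub>m n) S))"
    unfolding distance_seidel_eigenvalues_def S_def len[symmetric]
    by (simp add: distance_seidel_matrix_lex_product_K2[OF G.pair_wf_digraph assms(5,6) K2])
  also have "\<dots> = image_mset (\<lambda>x. 2 * x - 1) (proots (char_poly S)) + replicate_mset n 1"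
    by (rule proots_char_poly_doubled[OF S])
  also have "proots (char_poly S) = image_mset ev (mset_set {1..n})"
    using assms(9) by (simp add: distance_seidel_eigenvalues_def S_def)
  finally show ?thesis
    by (simp add: image_mset.compositionality o_def)
qed

end
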